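(* Let $M\ge 1$ and $r\ge 1$ be integers, let $p\in\mathbb{R}[\lambda_1,\dots,\lambda_M]$ have degree at most $2r$, and let $y^\star=(y^\star_\alpha)_{|\alpha|\le 2r}$ be an optimal solution of the order-$r$ moment relaxation of the mode-selection problem $\min\{p(\lambda):\lambda_j^2-\lambda_j=0\ \forall j,\ \mathbf{1}^T\lambda=1\}$. Suppose that $$\operatorname{rank} M_r(y^\star)=\operatorname{rank} M_{r-1}(y^\star)=1,$$ and let $\lambda^\star\in\mathbb{R}^M$ be the single point at which the representing measure of $y^\star$ is supported (under this rank condition such a representing measure exists, so that $y^\star_\alpha=(\lambda^\star)^\alpha$ for all $|\alpha|\le 2r$, and $\lambda^\star$ is a canonical basis vector). Then $$\lambda^\star_j=y^\star_{e_j}\quad (j=1,\dots,M),\qquad M_1(y^\star)=\begin{bmatrix}1&(\lambda^\star)^T\\ \lambda^\star&\lambda^\star(\lambda^\star)^T\end{bmatrix}.$$ Moreover, tightness of the order-$r$ relaxation is equivalent to $\operatorname{rank} M_r(y^\star)=1$.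
   Context: Here $\alpha\in\mathbb{N}^M$ is a multi-index, $|\alpha|=\sum_j\alpha_j$, $\lambda^\alpha=\prod_j\lambda_j^{\alpha_j}$, and $e_j$ is the $j$-th canonical basis vector (also viewed as a multi-index). $\mathbf{1}$ is the all-ones vector in $\mathbb{R}^M$. A truncated moment sequence is a real family $y=(y_\alpha)_{|\alpha|\le 2r}$ with $y_0=1$. The Riesz functional is $L_y(\sum_\alpha q_\alpha\lambda^\alpha)=\sum_\alpha q_\alpha y_\alpha$. For $0\le s\le r$, the moment matrix $M_s(y)$ is indexed by multi-indices $\alpha,\beta$ with $|\alpha|,|\beta|\le s$ and has entries $M_s(y)_{\alpha\beta}=y_{\alpha+\beta}$. For a polynomial $g=\sum_\gamma g_\gamma\lambda^\gamma$ of degree at most 2, the localizing matrix $M_{r-1}(gy)$ is indexed by $|\alpha|,|\beta|\le r-1$ and has entries $\sum_\gamma g_\gamma y_{\alpha+\beta+\gamma}$. The order-$r$ moment relaxation is: minimize $L_y(p)$ over truncated moment sequences $y=(y_\alpha)_{|\alpha|\le 2r}$ subject to $M_r(y)\succeq 0$, $M_{r-1}((\lambda_j^2-\lambda_j)y)=0$ for all $j$, and $M_{r-1}((\mathbf{1}^T\lambda-1)y)=0$. A representing measure for $y$ is a positive Borel measure $\mu$ on $\mathbb{R}^M$ with $y_\alpha=\int\lambda^\alpha\,d\mu$ for all $|\alpha|\le 2r$. The order-$r$ relaxation is called tight if there exists an optimal moment sequence from which one can extract an optimal feasible point of the original problem $\min\{p(\lambda):\lambda_j^2-\lambda_j=0\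 \forall j,\ \mathbf{1}^T\lambda=1\}$, namely as its vector of first-order moments $(y_{e_1},\dots,y_{e_M})$. *)

theory Defs
  imports "HOL-Analysis.Analysis" "HOL-Analysis.Finite_Function_Topology"
begin

text \<open>
  The number of variables \<open>M \<ge> 1\<close> is the cardinality of the finite index type \<open>'n\<close>.
  Multi-indices are finitely supported functions, and polynomials are elements of the monoid
  algebra of multi-indices over the reals, whose ring structure comes from the library.
\<close>

type_synonym 'n mindex = "'n \<Rightarrow>\<^sub>0 nat"
type_synonym 'n mpol = "'n mindex \<Rightarrow>\<^sub>0 real"

definition mdeg :: "'n::finite mindex \<Rightarrow> nat"
  where "mdeg \<alpha> = (\<Sum>j\<in>UNIV. Poly_Mapping.lookup \<alpha> j)"

definition midx :: "nat \<Rightarrow> 'n::finite mindex set"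
  where "midx s = {\<alpha>. mdeg \<alpha> \<le> s}"

text \<open>Sums and column spans over \<open>midx s\<close> are over a genuinely finite index set:\<close>

lemma finite_midx: "finite (midx s :: 'n::finite mindex set)"
proof -
  have "Poly_Mapping.lookup \<alpha> \<in> UNIV \<rightarrow>\<^sub>E {..s}" if "\<alpha> \<in> midx s" for \<alpha> :: "'n mindex"
  proof (rule PiE_I)
    fix j :: 'n
    have "Poly_Mapping.lookup \<alpha> j \<le> (\<Sum>i\<in>UNIV. Poly_Mapping.lookup \<alpha> i)"
      by (rule member_le_sum) auto
    with that show "Poly_Mapping.lookup \<alpha> j \<in> {..s}"
      by (simp add: midx_def mdeg_def)
  qed auto
  then have "Poly_Mapping.lookup ` (midx s :: 'n mindex set) \<subseteq> UNIV \<rightarrow>\<^sub>E {..s}"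
    by blast
  then have "finite (Poly_Mapping.lookup ` (midx s :: 'n mindex set))"
    by (rule finite_subset) (intro finite_PiE, auto)
  then show ?thesis
    by (rule finite_imageD) (auto simp: inj_on_def poly_mapping_eqI)
qed

definition unit_idx :: "'n::finite \<Rightarrow> 'n mindex"
  where "unit_idx j = Poly_Mapping.single j 1"

definition monom_val :: "real ^ 'n::finite \<Rightarrow> 'n mindex \<Rightarrow> real"
  where "monom_val x \<alpha> = (\<Prod>j\<in>UNIV. (x $ j) ^ Poly_Mapping.lookup \<alpha> j)"

definition total_deg :: "'n::finite mpol \<Rightarrow> nat"
  where "total_deg p = Max (insert 0 (mdeg ` Poly_Mapping.keys p))"

definition poly_val :: "'n::finite mpol \<Rightarrow> real ^ 'n \<Rightarrow> real"
  where "poly_val p x = (\<Sum>\<alpha>\<in>Poly_Mapping.keys p. Poly_Mapping.lookup p \<alpha> * monom_val x \<alpha>)"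

definition pvar :: "'n::finite \<Rightarrow> 'n mpol"
  where "pvar j = Poly_Mapping.single (unit_idx j) 1"

definition bin_con :: "'n::finite \<Rightarrow> 'n mpol"
  where "bin_con j = pvar j ^ 2 - pvar j"

definition sum_con :: "'n::finite mpol"
  where "sum_con = (\<Sum>j\<in>UNIV. pvar j) - 1"

text \<open>
  Sequences are total functions on multi-indices; all notions below that take an order \<open>r\<close>
  depend only on the entries with \<open>mdeg \<alpha> \<le> 2 * r\<close> (given \<open>r \<ge> 1\<close> and \<open>total_deg p \<le> 2 * r\<close>),
  so the values beyond the truncation are irrelevant.
\<close>

definition riesz :: "('n::finite mindex \<Rightarrow> real) \<Rightarrow> 'n mpol \<Rightarrow> real"
  where "riesz y q = (\<Sum>\<alpha>\<in>Poly_Mapping.keys q. Poly_Mapping.lookup q \<alpha> * y \<alpha>)"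

text \<open>Matrices of order \<open>s\<close> are functions of two multi-indices restricted to \<open>midx s\<close>.\<close>

definition moment_mat :: "('n::finite mindex \<Rightarrow> real) \<Rightarrow> 'n mindex \<Rightarrow> 'n mindex \<Rightarrow> real"
  where "moment_mat y \<alpha> \<beta> = y (\<alpha> + \<beta>)"

definition localizing_mat ::
    "'n::finite mpol \<Rightarrow> ('n mindex \<Rightarrow> real) \<Rightarrow> 'n mindex \<Rightarrow> 'n mindex \<Rightarrow> real"
  where "localizing_mat g y \<alpha> \<beta> = (\<Sum>\<gamma>\<in>Poly_Mapping.keys g. Poly_Mapping.lookup g \<gamma> * y (\<alpha> + \<beta> + \<gamma>))"

definition psd_on :: "'i set \<Rightarrow> ('i \<Rightarrow> 'i \<Rightarrow> real) \<Rightarrow> bool"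
  where "psd_on I A \<longleftrightarrow>
    (\<forall>a\<in>I. \<forall>b\<in>I. A a b = A b a) \<and>
    (\<forall>v. 0 \<le> (\<Sum>a\<in>I. \<Sum>b\<in>I. v a * A a b * v b))"

text \<open>Column rank over a finite index set; a column is a finitely supported vector.\<close>

definition rank_on :: "'i set \<Rightarrow> ('i \<Rightarrow> 'i \<Rightarrow> real) \<Rightarrow> nat"
  where "rank_on I A = dim ((\<lambda>b. \<Sum>a\<in>I. Poly_Mapping.single a (A a b)) ` I)"

definition moment_rank :: "nat \<Rightarrow> ('n::finite mindex \<Rightarrow> real) \<Rightarrow> nat"
  where "moment_rank s y = rank_on (midx s) (moment_mat y)"

definition relax_feasible :: "nat \<Rightarrow> ('n::finite mindex \<Rightarrow> real) \<Rightarrow> bool"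
  where "relax_feasible r y \<longleftrightarrow>
    y 0 = 1 \<and>
    psd_on (midx r) (moment_mat y) \<and>
    (\<forall>j. \<forall>\<alpha>\<in>midx (r - 1). \<forall>\<beta>\<in>midx (r - 1). localizing_mat (bin_con j) y \<alpha> \<beta> = 0) \<and>
    (\<forall>\<alpha>\<in>midx (r - 1). \<forall>\<beta>\<in>midx (r - 1). localizing_mat sum_con y \<alpha> \<beta> = 0)"

definition relax_optimal :: "nat \<Rightarrow> 'n::finite mpol \<Rightarrow> ('n mindex \<Rightarrow> real) \<Rightarrow> bool"
  where "relax_optimal r p y \<longleftrightarrow>
    relax_feasible r y \<and> (\<forall>z. relax_feasible r z \<longrightarrow> riesz y p \<le> riesz z p)"

definition mode_feasible :: "real ^ 'n::finite \<Rightarrow> bool"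
  where "mode_feasible x \<longleftrightarrow> (\<forall>j. (x $ j)\<^sup>2 - x $ j = 0) \<and> (\<Sum>j\<in>UNIV. x $ j) = 1"

definition mode_optimal :: "'n::finite mpol \<Rightarrow> real ^ 'n \<Rightarrow> bool"
  where "mode_optimal p x \<longleftrightarrow>
    mode_feasible x \<and> (\<forall>z. mode_feasible z \<longrightarrow> poly_val p x \<le> poly_val p z)"

definition first_moments :: "('n::finite mindex \<Rightarrow> real) \<Rightarrow> real ^ 'n"
  where "first_moments y = (\<chi> j. y (unit_idx j))"

definition tight :: "nat \<Rightarrow> 'n::finite mpol \<Rightarrow> bool"
  where "tight r p \<longleftrightarrow> (\<exists>y. relax_optimal r p y \<and> mode_optimal p (first_moments y))"

definition representing_measure ::
    "nat \<Rightarrow> ('n::finite mindex \<Rightarrow> real) \<Rightarrow> (real ^ 'n) measure \<Rightarrow> bool"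
  where "representing_measure r y \<mu> \<longleftrightarrow>
    sets \<mu> = sets borel \<and>
    (\<forall>\<alpha>\<in>midx (2 * r).
       integrable \<mu> (\<lambda>x. monom_val x \<alpha>) \<and> y \<alpha> = (LINT x|\<mu>. monom_val x \<alpha>))"

text \<open>
  By the following lemma, a matrix of order \<open>1\<close> is determined by its four blocks, indexed by
  \<open>0\<close> and by the multi-indices \<open>unit_idx j\<close>.
\<close>

lemma midx_1: "midx 1 = insert 0 (range (unit_idx :: 'n::finite \<Rightarrow> 'n mindex))"
proof (intro equalityI subsetI)
  fix \<alpha> :: "'n mindex"
  assume "\<alpha> \<in> midx 1"
  then have le: "(\<Sum>j\<in>UNIV. Poly_Mapping.lookup \<alpha> j) \<le> 1"
    by (simp add: midx_def mdeg_def)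
  show "\<alpha> \<in> insert 0 (range unit_idx)"
  proof (cases "\<alpha> = 0")
    case False
    then obtain i where i: "Poly_Mapping.lookup \<alpha> i \<noteq> 0"
      by (metis lookup_zero poly_mapping_eqI)
    have eq: "(\<Sum>j\<in>UNIV. Poly_Mapping.lookup \<alpha> j) = Poly_Mapping.lookup \<alpha> i + (\<Sum>j\<in>UNIV - {i}. Poly_Mapping.lookup \<alpha> j)"
      by (simp add: sum.remove)
    with le i have "Poly_Mapping.lookup \<alpha> i = 1" and "(\<Sum>j\<in>UNIV - {i}. Poly_Mapping.lookup \<alpha> j) = 0"
      by linarith+
    then have "\<alpha> = unit_idx i"
      by (auto simp: unit_idx_def lookup_single when_def intro!: poly_mapping_eqI)
    then show ?thesis by simp
  qed simp
next
  fix \<alpha> :: "'n mindex"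
  assume "\<alpha> \<in> insert 0 (range unit_idx)"
  then show "\<alpha> \<in> midx 1"
    by (auto simp: midx_def mdeg_def unit_idx_def lookup_single when_def)
qed

end

theory Submission
  imports Defs "HOL-Probability.Giry_Monad"
begin

text \<open>
  For a feasible sequence \<open>y\<close> the binary constraints allow a repeated variable in a monomial to be
  dropped, so once the first-order moments form a basis vector \<open>axis i 1\<close>, positive
  semidefiniteness forces every moment involving a variable \<open>j \<noteq> i\<close> to vanish, and \<open>y\<close> is the
  moment sequence of a point mass.
  Conversely, rank one means that the moments of degree at most \<open>r\<close> are multiplicative, and the
  constraints then say that the first-order moments are feasible for the mode-selection problem.
  Since point masses at feasible modes are feasible for the relaxation, optimality transfers.
\<close>

subsection \<open>Multi-indices and monomials\<close>

lemma mdeg_zero [simp]: "mdeg 0 = 0"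
  by (simp add: mdeg_def)

lemma mdeg_add [simp]: "mdeg (\<alpha> + \<beta>) = mdeg \<alpha> + mdeg \<beta>"
  by (simp add: mdeg_def lookup_add sum.distrib)

lemma mdeg_unit_idx [simp]: "mdeg (unit_idx j) = 1"
  by (simp add: mdeg_def unit_idx_def lookup_single when_def)

lemma mdeg_eq_0_iff: "mdeg \<alpha> = 0 \<longleftrightarrow> \<alpha> = 0"
  by (auto simp: mdeg_def intro: poly_mapping_eqI)

lemma zero_in_midx [simp]: "0 \<in> midx s"
  by (simp add: midx_def)

lemma mindex_nonzeroE:
  fixes \<alpha> :: "'n::finite mindex"
  assumes "\<alpha> \<noteq> 0"
  obtains i \<beta> where "\<alpha> = unit_idx i + \<beta>"
proof -
  from assms obtain i where i: "Poly_Mapping.lookup \<alpha> i \<noteq> 0"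
    by (metis lookup_zero poly_mapping_eqI)
  \<comment> \<open>Subtraction of multi-indices truncates pointwise at zero; it is exact here
    because \<alpha> is nonzero at \<open>i\<close>.\<close>
  have "\<alpha> = unit_idx i + (\<alpha> - unit_idx i)"
    using i by (intro poly_mapping_eqI)
      (auto simp: unit_idx_def lookup_add lookup_minus lookup_single when_def)
  then show thesis by (rule that)
qed

text \<open>Matrix entries are indexed by pairs, so a moment of given degree has to be presented as
  an entry \<open>(\<beta>, \<gamma>)\<close> with both indices in range. The induction moves one
  variable at a time into \<beta>.\<close>

lemma mindex_split:
  fixes \<alpha> :: "'n::finite mindex"
  assumes "mdeg \<alpha> \<le> m + n"
  shows "\<exists>\<beta> \<gamma>. \<alpha> = \<beta> + \<gamma> \<and> mdeg \<beta> \<le> m \<and> mdeg \<gamma> \<le> n"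
  using assms
proof (induction m arbitrary: \<alpha>)
  case 0
  then show ?case by (intro exI[of _ 0] exI[of _ \<alpha>]) simp
next
  case (Suc m)
  show ?case
  proof (cases "\<alpha> = 0")
    case True
    then show ?thesis by (intro exI[of _ 0]) simp
  next
    case False
    then obtain i \<alpha>' where \<alpha>: "\<alpha> = unit_idx i + \<alpha>'"
      by (rule mindex_nonzeroE)
    with Suc.prems have "mdeg \<alpha>' \<le> m + n" by simp
    then obtain \<beta> \<gamma> where "\<alpha>' = \<beta> + \<gamma>" "mdeg \<beta> \<le> m" "mdeg \<gamma> \<le> n"
      using Suc.IH by blast
    with \<alpha> show ?thesis
      by (intro exI[of _ "unit_idx i + \<beta>"] exI[of _ \<gamma>]) (simp add: add.assoc)
  qed
qed

lemma monom_val_zero [simp]: "monom_val x 0 = 1"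
  by (simp add: monom_val_def)

lemma monom_val_add: "monom_val x (\<alpha> + \<beta>) = monom_val x \<alpha> * monom_val x \<beta>"
  by (simp add: monom_val_def lookup_add power_add prod.distrib)

lemma monom_val_unit_idx [simp]: "monom_val x (unit_idx j) = x $ j"
proof -
  have "monom_val x (unit_idx j) = (\<Prod>k\<in>UNIV. if k = j then x $ k else 1)"
    unfolding monom_val_def unit_idx_def
    by (intro prod.cong) (auto simp: lookup_single when_def)
  then show ?thesis by simp
qed

subsection \<open>The constraints of the relaxation in terms of moments\<close>

text \<open>Cancellation can make the keys of a sum smaller than the union of the keys; linearity is
  therefore proved over a common finite superset.\<close>

lemma riesz_superset:
  assumes "finite S" "Poly_Mapping.keys q \<subseteq> S"
  shows "riesz y q = (\<Sum>\<alpha>\<in>S. Poly_Mapping.lookup q \<alpha> * y \<alpha>)"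
  unfolding riesz_def using assms
  by (intro sum.mono_neutral_left) (auto simp: in_keys_iff)

lemma riesz_single: "riesz y (Poly_Mapping.single \<alpha> c) = c * y \<alpha>"
  by (subst riesz_superset[of "{\<alpha>}"]) (auto simp: lookup_single)

lemma riesz_one: "riesz y 1 = y 0"
  using riesz_single[of y 0 1] by simp

lemma riesz_zero: "riesz y 0 = 0"
  by (simp add: riesz_def)

lemma riesz_add: "riesz y (p + q) = riesz y p + riesz y q"
proof -
  let ?S = "Poly_Mapping.keys p \<union> Poly_Mapping.keys q"
  have "Poly_Mapping.keys (p + q) \<subseteq> ?S" by (rule Poly_Mapping.keys_add)
  then show ?thesis
    by (simp add: riesz_superset[of ?S] lookup_add algebra_simps sum.distrib)
qed

lemma riesz_diff: "riesz y (p - q) = riesz y p - riesz y q"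
  using riesz_add[of y "p - q" q] by simp

lemma riesz_sum: "riesz y (\<Sum>i\<in>A. f i) = (\<Sum>i\<in>A. riesz y (f i))"
  by (induction A rule: infinite_finite_induct) (simp_all add: riesz_zero riesz_add)

text \<open>Linearity of the Riesz functional of the shifted sequence then evaluates the constraints
  without determining the keys of \<open>bin_con\<close> and \<open>sum_con\<close>.\<close>

lemma localizing_mat_riesz: "localizing_mat g y \<alpha> \<beta> = riesz (\<lambda>\<gamma>. y (\<alpha> + \<beta> + \<gamma>)) g"
  by (simp add: localizing_mat_def riesz_def)

lemma localizing_mat_bin_con:
  "localizing_mat (bin_con j) y \<alpha> \<beta> = y (\<alpha> + \<beta> + unit_idx j + unit_idx j) - y (\<alpha> + \<beta> + unit_idx j)"
  by (simp add: localizing_mat_riesz bin_con_def pvar_def riesz_diff riesz_single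
      power2_eq_square mult_single add.assoc)

lemma localizing_mat_sum_con:
  "localizing_mat sum_con y \<alpha> \<beta> = (\<Sum>j\<in>UNIV. y (\<alpha> + \<beta> + unit_idx j)) - y (\<alpha> + \<beta>)"
  by (simp add: localizing_mat_riesz sum_con_def pvar_def riesz_diff riesz_sum riesz_single riesz_one)

lemma relax_feasible_zero: "relax_feasible r y \<Longrightarrow> y 0 = 1"
  by (simp add: relax_feasible_def)

lemma relax_feasible_idem:
  fixes y :: "'n::finite mindex \<Rightarrow> real"
  assumes "relax_feasible r y" "r \<ge> 1" "mdeg \<alpha> + 2 \<le> 2 * r"
  shows "y (\<alpha> + unit_idx j + unit_idx j) = y (\<alpha> + unit_idx j)"
proof -
  have "mdeg \<alpha> \<le> (r - 1) + (r - 1)" using assms by linarith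
  then obtain \<beta> \<gamma> where "\<alpha> = \<beta> + \<gamma>" "mdeg \<beta> \<le> r - 1" "mdeg \<gamma> \<le> r - 1"
    using mindex_split by blast
  moreover from this have "localizing_mat (bin_con j) y \<beta> \<gamma> = 0"
    using assms(1) by (auto simp: relax_feasible_def midx_def)
  ultimately show ?thesis by (simp add: localizing_mat_bin_con)
qed

lemma relax_feasible_sum:
  assumes "relax_feasible r y"
  shows "(\<Sum>j\<in>UNIV. y (unit_idx j)) = 1"
proof -
  have "localizing_mat sum_con y 0 0 = 0"
    using assms zero_in_midx unfolding relax_feasible_def by blast
  then show ?thesis
    using relax_feasible_zero[OF assms] by (simp add: localizing_mat_sum_con)
qed

text \<open>With \<open>A a a = 0\<close> the quadratic form at t times the \<open>a\<close>-th plus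
  the \<open>b\<close>-th basis vector is affine in t; being nonnegative for every t, it has slope
  zero.\<close>

lemma psd_on_zero_diagonal:
  assumes psd: "psd_on I A" and I: "finite I" "a \<in> I" "b \<in> I" and zero: "A a a = 0"
  shows "A a b = 0"
proof (cases "a = b")
  case False
  have sym: "A b a = A a b" using psd I by (simp add: psd_on_def)
  have quad: "0 \<le> 2 * t * A a b + A b b" for t
  proof -
    define v where "v = (\<lambda>c. if c = a then t else if c = b then 1 else 0)"
    have supp: "(\<Sum>c\<in>I. v c * f c) = t * f a + f b" for f
    proof -
      have "(\<Sum>c\<in>I. v c * f c) = (\<Sum>c\<in>{a, b}. v c * f c)"
        using I by (intro sum.mono_neutral_right) (auto simp: v_def)
      then show ?thesis using False by (simp add: v_def)
    qed
    have "0 \<le> (\<Sum>c\<in>I. \<Sum>d\<in>I. v c * A c d * v d)"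
      using psd by (simp add: psd_on_def)
    also have "\<dots> = (\<Sum>c\<in>I. v c * (\<Sum>d\<in>I. v d * A c d))"
      by (simp add: sum_distrib_left mult_ac)
    also have "\<dots> = t * (t * A a a + A a b) + (t * A b a + A b b)"
      by (simp only: supp)
    also have "\<dots> = 2 * t * A a b + A b b"
      using sym zero by simp
    finally show ?thesis .
  qed
  show ?thesis
  proof (rule ccontr)
    assume "A a b \<noteq> 0"
    \<comment> \<open>This value of t solves \<open>2 * t * A a b + A b b = -1\<close>.\<close>
    then have "2 * (- (A b b + 1) / (2 * A a b)) * A a b + A b b = - 1"
      by (simp add: field_simps)
    with quad[of "- (A b b + 1) / (2 * A a b)"] show False by linarith
  qed
qed (use zero in simp)

subsection \<open>Rigidity of feasible sequences with integral first-order moments\<close>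

text \<open>
  A monomial divisible by the variable \<open>j\<close> is split into two halves \<open>\<beta>'\<close> and \<open>\<gamma>\<close> with \<open>j\<close> in \<open>\<beta>'\<close>,
  rounded so that \<open>y (\<beta>' + \<beta>')\<close>, once a repeated \<open>j\<close> is dropped, has smaller degree. It is zero by
  induction, and so is the whole row \<open>\<beta>'\<close> of the moment matrix.
\<close>

lemma relax_feasible_vanish:
  fixes y :: "'n::finite mindex \<Rightarrow> real"
  assumes feas: "relax_feasible r y" and r: "r \<ge> 1" and zero: "y (unit_idx j) = 0"
    and deg: "mdeg \<alpha> < 2 * r"
  shows "y (unit_idx j + \<alpha>) = 0"
  using deg
proof (induction "mdeg \<alpha>" arbitrary: \<alpha> rule: less_induct)
  case less
  show ?case
  proof (cases "\<alpha> = 0")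
    case True
    then show ?thesis using zero by simp
  next
    case False
    define n where "n = mdeg \<alpha>"
    have n: "n \<ge> 1" "n < 2 * r"
      using False less.prems mdeg_eq_0_iff[of \<alpha>] by (auto simp: n_def)
    \<comment> \<open>The total degree is n + 1, and the half containing \<open>j\<close> is rounded
      down: twice the degree of \<beta> is then at most n - 1, whereas rounding up would allow n for
      even n. The other half still has degree at most \<open>r\<close>, since n + 1 \<le> 2
      r.\<close>
    have "mdeg \<alpha> \<le> ((n + 1) div 2 - 1) + (n + 1 - (n + 1) div 2)"
      using n unfolding n_def[symmetric] by linarith
    then obtain \<beta> \<gamma> where \<alpha>: "\<alpha> = \<beta> + \<gamma>"
      and \<beta>: "mdeg \<beta> \<le> (n + 1) div 2 - 1" and \<gamma>: "mdeg \<gamma> \<le> n + 1 - (n + 1) div 2"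
      using mindex_split by blast
    have lt: "mdeg (\<beta> + \<beta>) < n" using \<beta> n by simp
    have "y (unit_idx j + (\<beta> + \<beta>)) = 0"
      using less.hyps[of "\<beta> + \<beta>"] lt n by (simp add: n_def)
    moreover have "y ((\<beta> + \<beta>) + unit_idx j + unit_idx j) = y ((\<beta> + \<beta>) + unit_idx j)"
      using lt n by (intro relax_feasible_idem[OF feas r]) linarith
    ultimately have diag: "moment_mat y (unit_idx j + \<beta>) (unit_idx j + \<beta>) = 0"
      by (simp add: moment_mat_def add_ac)
    have "psd_on (midx r) (moment_mat y)" using feas by (simp add: relax_feasible_def)
    moreover have "unit_idx j + \<beta> \<in> midx r" "\<gamma> \<in> midx r"
      using \<beta> \<gamma> n by (auto simp: midx_def)
    ultimately have "moment_mat y (unit_idx j + \<beta>) \<gamma> = 0"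
      using diag by (rule psd_on_zero_diagonal[OF _ finite_midx])
    then show ?thesis by (simp add: moment_mat_def \<alpha> add.assoc)
  qed
qed

text \<open>Coordinates are 0 or 1, so their sum counts the ones, and the linear constraint leaves
  exactly one.\<close>

lemma mode_feasible_axis:
  fixes x :: "real ^ 'n::finite"
  assumes "mode_feasible x"
  obtains i where "x = axis i 1"
proof -
  have bin: "x $ j = 0 \<or> x $ j = 1" for j
  proof -
    have "x $ j * (x $ j - 1) = 0"
      using assms by (simp add: mode_feasible_def power2_eq_square algebra_simps)
    then show ?thesis by simp
  qed
  have "(\<Sum>j\<in>UNIV. x $ j) = (\<Sum>j\<in>UNIV. of_bool (x $ j = 1))"
    by (intro sum.cong refl) (metis bin of_bool_eq)
  also have "\<dots> = real (card {j. x $ j = 1})"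
    by simp
  finally have "card {j. x $ j = 1} = 1"
    using assms by (simp add: mode_feasible_def)
  then obtain i where "{j. x $ j = 1} = {i}"
    by (rule card_1_singletonE)
  then have "x = axis i 1"
    using bin by (auto simp: vec_eq_iff axis_def)
  then show thesis by (rule that)
qed

text \<open>Let \<open>i\<close> be the coordinate where the mode is 1. Both sides vanish once
  \<alpha> contains another variable; otherwise \<alpha> is a power of variable \<open>i\<close>,
  and idempotence lowers the exponent down to a first-order moment.\<close>

lemma relax_feasible_eq_monom_val:
  fixes y :: "'n::finite mindex \<Rightarrow> real"
  assumes feas: "relax_feasible r y" and r: "r \<ge> 1" and mode: "mode_feasible (first_moments y)"
    and deg: "mdeg \<alpha> \<le> 2 * r"
  shows "y \<alpha> = monom_val (first_moments y) \<alpha>"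
  using deg
proof (induction "mdeg \<alpha>" arbitrary: \<alpha> rule: less_induct)
  case less
  let ?x = "first_moments y"
  obtain i where i: "?x = axis i 1"
    using mode by (rule mode_feasible_axis)
  have x: "?x $ j = y (unit_idx j)" for j
    by (simp add: first_moments_def)
  have xi: "?x $ i = 1"
    by (simp add: i axis_def)
  have x0: "?x $ j = 0" if "j \<noteq> i" for j
    using that by (simp add: i axis_def)
  have vanish: ?case if "\<alpha> = unit_idx j + \<beta>" "j \<noteq> i" for j \<beta>
  proof -
    have "y \<alpha> = 0"
      using that less.prems x0[of j] x[of j] relax_feasible_vanish[OF feas r, of j \<beta>] by simp
    then show ?thesis using that x0[of j] by (simp add: monom_val_add)
  qed
  show ?case
  proof (cases "\<alpha> = 0")
    case True
    then show ?thesis using relax_feasible_zero[OF feas] by simp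
  next
    case False
    then obtain j \<beta> where \<alpha>: "\<alpha> = unit_idx j + \<beta>" by (rule mindex_nonzeroE)
    show ?thesis
    proof (cases "j = i")
      case False
      with \<alpha> show ?thesis by (rule vanish)
    next
      case [simp]: True
      show ?thesis
      proof (cases "\<beta> = 0")
        case True
        then show ?thesis using \<alpha> x by simp
      next
        case False
        then obtain k \<gamma> where \<beta>: "\<beta> = unit_idx k + \<gamma>" by (rule mindex_nonzeroE)
        show ?thesis
        proof (cases "k = i")
          case False
          then show ?thesis
            using \<alpha> \<beta> by (intro vanish[of k "unit_idx j + \<gamma>"]) (simp_all add: add_ac)
        next
          case [simp]: True
          have \<alpha>': "\<alpha> = \<gamma> + unit_idx i + unit_idx i"
            using \<alpha> \<beta> by (simp add: add_ac)
          have "y \<alpha> = y (\<gamma> + unit_idx i)"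
            unfolding \<alpha>' using less.prems \<alpha>' by (intro relax_feasible_idem[OF feas r]) simp
          also have "\<dots> = monom_val ?x (\<gamma> + unit_idx i)"
            using less.prems \<alpha>' by (intro less.hyps) simp_all
          also have "\<dots> = monom_val ?x \<alpha>"
            using xi by (simp add: \<alpha>' monom_val_add)
          finally show ?thesis .
        qed
      qed
    qed
  qed
qed

subsection \<open>Rank one\<close>

text \<open>Scaling is defined through \<open>Abs_poly_mapping\<close>, so reading off its values
  requires the finite support of the scaled function.\<close>

lemma lookup_scaleR: "Poly_Mapping.lookup (c *\<^sub>R v) a = c * Poly_Mapping.lookup v a"
proof -
  have "finite {i. c * Poly_Mapping.lookup v i \<noteq> 0}"
    by (rule finite_subset[OF _ finite_keys[of v]]) (auto simp: in_keys_iff)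
  then show ?thesis
    by (simp add: scaleR_poly_mapping_def Abs_poly_mapping_inverse)
qed

lemma lookup_column:
  assumes "finite I" "a \<in> I"
  shows "Poly_Mapping.lookup (\<Sum>c\<in>I. Poly_Mapping.single c (f c)) a = f a"
proof -
  have "Poly_Mapping.lookup (\<Sum>c\<in>I. Poly_Mapping.single c (f c)) a = (\<Sum>c\<in>I. if c = a then f c else 0)"
    unfolding lookup_sum by (intro sum.cong) (auto simp: lookup_single when_def)
  then show ?thesis using assms by simp
qed

text \<open>All columns are multiples of one vector v. If columns \<open>b\<close> and
  \<open>c\<close> have coefficients s and t, both sides equal s times the \<open>a\<close>-th entry
  of v, because t times its \<open>c\<close>-th entry is \<open>A c c = 1\<close>.\<close>

lemma rank_on_1_D:
  assumes rank: "rank_on I A = 1" and I: "finite I" "a \<in> I" "b \<in> I" "c \<in> I" and one: "A c c = 1"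
  shows "A a b = A a c * A c b"
proof -
  define col where "col = (\<lambda>b. \<Sum>a\<in>I. Poly_Mapping.single a (A a b))"
  have lookup_col: "Poly_Mapping.lookup (col b) a = A a b" if "a \<in> I" for a b
    using I that by (simp add: col_def lookup_column)
  obtain B where B: "B \<subseteq> col ` I" "independent B" "col ` I \<subseteq> span B" "card B = dim (col ` I)"
    using real_vector.basis_exists[of "col ` I"] by blast
  have "dim (col ` I) = 1" using rank by (simp add: rank_on_def col_def)
  with B(4) obtain v where "B = {v}" by (metis card_1_singletonE)
  with B(3) I have "col b \<in> span {v}" "col c \<in> span {v}" by auto
  then obtain s t where s: "col b = s *\<^sub>R v" and t: "col c = t *\<^sub>R v"
    by (auto simp: span_singleton)
  have "A a b = s * Poly_Mapping.lookup v a" "A c b = s * Poly_Mapping.lookup v c"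
    "A a c = t * Poly_Mapping.lookup v a" "A c c = t * Poly_Mapping.lookup v c"
    using s t I by (metis lookup_col lookup_scaleR)+
  then show ?thesis using one by (simp add: mult_ac)
qed

text \<open>Column \<open>b\<close> is \<open>A c b\<close> times column \<open>c\<close>, which is
  nonzero because its entry at \<open>c\<close> is 1.\<close>

lemma rank_on_1_I:
  assumes I: "finite I" "c \<in> I" and one: "A c c = 1"
    and mult: "\<And>a b. a \<in> I \<Longrightarrow> b \<in> I \<Longrightarrow> A a b = A a c * A c b"
  shows "rank_on I A = 1"
proof -
  define col where "col = (\<lambda>b. \<Sum>a\<in>I. Poly_Mapping.single a (A a b))"
  have "Poly_Mapping.lookup (col c) c = 1"
    using I one by (simp add: col_def lookup_column)
  then have nz: "col c \<noteq> 0" by auto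
  have "col b = A c b *\<^sub>R col c" if "b \<in> I" for b
    unfolding col_def scaleR_sum_right using mult[OF _ that]
    by (intro sum.cong poly_mapping_eqI) (auto simp: lookup_single lookup_scaleR when_def)
  then have "col ` I \<subseteq> span {col c}" by (auto simp: span_singleton)
  then have "dim (col ` I) = card {col c}"
    using nz I by (intro real_vector.dim_unique) auto
  then show ?thesis by (simp add: rank_on_def col_def)
qed

text \<open>Moments of a point form an outer product, of rank one. Conversely, rank one with
  reference index 0 gives \<open>y (unit_idx j + unit_idx j)\<close> as the square of
  \<open>y (unit_idx j)\<close>, and idempotence turns this into the binary equation.\<close>

lemma mode_feasible_iff_moment_rank:
  fixes y :: "'n::finite mindex \<Rightarrow> real"
  assumes feas: "relax_feasible r y" and r: "r \<ge> 1"
  shows "mode_feasible (first_moments y) \<longleftrightarrow> moment_rank r y = 1"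
proof
  assume mode: "mode_feasible (first_moments y)"
  have y: "y \<alpha> = monom_val (first_moments y) \<alpha>" if "mdeg \<alpha> \<le> 2 * r" for \<alpha>
    using relax_feasible_eq_monom_val[OF feas r mode that] .
  show "moment_rank r y = 1"
    unfolding moment_rank_def
    by (rule rank_on_1_I[OF finite_midx zero_in_midx])
      (auto simp: moment_mat_def y midx_def monom_val_add)
next
  assume rank: "moment_rank r y = 1"
  have "y (unit_idx j + unit_idx j) = y (unit_idx j) * y (unit_idx j)" for j
    using rank_on_1_D[OF rank[unfolded moment_rank_def] finite_midx, of "unit_idx j" "unit_idx j" 0]
      r relax_feasible_zero[OF feas] by (simp add: moment_mat_def midx_def)
  moreover have "y (unit_idx j + unit_idx j) = y (unit_idx j)" for j
    using relax_feasible_idem[OF feas r, of 0 j] r by simp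
  ultimately show "mode_feasible (first_moments y)"
    using relax_feasible_sum[OF feas]
    by (simp add: mode_feasible_def first_moments_def power2_eq_square)
qed

subsection \<open>Transfer of optimality\<close>

text \<open>The quadratic form is a perfect square, and each localizing entry is a monomial value
  times a constraint evaluated at \<open>x\<close>.\<close>

lemma relax_feasible_monom_val:
  assumes "mode_feasible x"
  shows "relax_feasible r (monom_val x)"
proof -
  have sq: "x $ j * x $ j = x $ j" for j
    using assms by (simp add: mode_feasible_def power2_eq_square)
  have "0 \<le> (\<Sum>a\<in>midx r. \<Sum>b\<in>midx r. v a * moment_mat (monom_val x) a b * v b)" for v
  proof -
    have "(\<Sum>a\<in>midx r. \<Sum>b\<in>midx r. v a * moment_mat (monom_val x) a b * v b)
        = (\<Sum>a\<in>midx r. v a * monom_val x a)\<^sup>2"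
      by (simp add: power2_eq_square sum_product moment_mat_def monom_val_add mult_ac)
    then show ?thesis by simp
  qed
  moreover have "localizing_mat sum_con (monom_val x) \<alpha> \<beta> = 0" for \<alpha> \<beta>
    using assms
    by (simp add: localizing_mat_sum_con monom_val_add mode_feasible_def flip: sum_distrib_left)
  moreover have "localizing_mat (bin_con j) (monom_val x) \<alpha> \<beta> = 0" for j \<alpha> \<beta>
    by (simp add: localizing_mat_bin_con monom_val_add mult.assoc sq)
  ultimately show ?thesis
    by (simp add: relax_feasible_def psd_on_def) (simp add: moment_mat_def add.commute)
qed

lemma riesz_monom_val: "riesz (monom_val x) p = poly_val p x"
  by (simp add: riesz_def poly_val_def)

lemma riesz_cong:
  assumes "total_deg p \<le> d" "\<And>\<alpha>. mdeg \<alpha> \<le> d \<Longrightarrow> y \<alpha> = z \<alpha>"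
  shows "riesz y p = riesz z p"
proof -
  have "mdeg \<alpha> \<le> d" if "\<alpha> \<in> Poly_Mapping.keys p" for \<alpha>
  proof -
    have "mdeg \<alpha> \<le> total_deg p"
      unfolding total_deg_def using that by (intro Max_ge) auto
    with assms(1) show ?thesis by simp
  qed
  then show ?thesis unfolding riesz_def using assms(2) by (intro sum.cong) auto
qed

text \<open>The relaxed optimum bounds the objective at every mode from below. A feasible vector of
  first moments attains this bound, so only its feasibility is in question.\<close>

lemma mode_optimal_iff_moment_rank:
  fixes y :: "'n::finite mindex \<Rightarrow> real"
  assumes r: "r \<ge> 1" and deg: "total_deg p \<le> 2 * r" and opt: "relax_optimal r p y"
  shows "mode_optimal p (first_moments y) \<longleftrightarrow> moment_rank r y = 1"
proof -
  have feas: "relax_feasible r y" using opt by (simp add: relax_optimal_def)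
  have "mode_optimal p (first_moments y)" if mode: "mode_feasible (first_moments y)"
  proof -
    have "poly_val p (first_moments y) \<le> poly_val p z" if "mode_feasible z" for z
    proof -
      have "poly_val p (first_moments y) = riesz y p"
        unfolding riesz_monom_val[symmetric]
        using relax_feasible_eq_monom_val[OF feas r mode]
        by (intro riesz_cong[OF deg]) simp
      also have "\<dots> \<le> riesz (monom_val z) p"
        using opt relax_feasible_monom_val[OF that] by (simp add: relax_optimal_def)
      finally show ?thesis by (simp add: riesz_monom_val)
    qed
    with mode show ?thesis by (simp add: mode_optimal_def)
  qed
  then show ?thesis
    using mode_feasible_iff_moment_rank[OF feas r] by (auto simp: mode_optimal_def)
qed

subsection \<open>The representing measure\<close>

lemma borel_measurable_monom_val [measurable]: "(\<lambda>x. monom_val x \<alpha>) \<in> borel_measurable borel"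
  unfolding monom_val_def by (intro borel_measurable_continuous_onI continuous_intros)

lemma representing_measure_point:
  fixes x :: "real ^ 'n::finite"
  assumes "\<And>\<alpha>. mdeg \<alpha> \<le> 2 * r \<Longrightarrow> y \<alpha> = monom_val x \<alpha>"
  shows "representing_measure r y (return borel x)"
proof -
  have "integrable (return borel x) (\<lambda>x. monom_val x \<alpha>)" for \<alpha>
    by (rule integrableI_bounded) (simp_all add: nn_integral_return)
  then show ?thesis
    using assms by (auto simp: representing_measure_def midx_def integral_return)
qed

text \<open>The second central moments of the measure vanish.\<close>

lemma representing_measure_point_unique:
  fixes x :: "real ^ 'n::finite"
  assumes y: "\<And>\<alpha>. mdeg \<alpha> \<le> 2 * r \<Longrightarrow> y \<alpha> = monom_val x \<alpha>"
    and r: "r \<ge> 1" and \<nu>: "representing_measure r y \<nu>"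
  shows "\<nu> = return borel x"
proof -
  have sets [measurable_cong]: "sets \<nu> = sets borel"
    using \<nu> by (simp add: representing_measure_def)
  have space: "space \<nu> = UNIV" using sets_eq_imp_space_eq[OF sets] by simp
  have int: "integrable \<nu> (\<lambda>z. monom_val z \<alpha>)"
    and val: "(LINT z|\<nu>. monom_val z \<alpha>) = monom_val x \<alpha>" if "mdeg \<alpha> \<le> 2 * r" for \<alpha>
    using \<nu> that y[OF that] by (auto simp: representing_measure_def midx_def)
  \<comment> \<open>The moment of index 0 makes \<nu> finite with total mass 1.\<close>
  have int0: "integrable \<nu> (\<lambda>z. 1 :: real)" and val0: "(LINT z|\<nu>. 1 :: real) = 1"
    using int[of 0] val[of 0] by simp_all
  have "emeasure \<nu> (space \<nu>) < \<infinity>"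
    using int0 by (simp add: integrable_iff_bounded)
  then interpret finite_measure \<nu> by (intro finite_measureI) simp
  have total: "measure \<nu> UNIV = 1" using val0 by (simp add: space)
  have ae: "AE z in \<nu>. z $ j = x $ j" for j
  proof -
    have int1: "integrable \<nu> (\<lambda>z. z $ j)" and val1: "(LINT z|\<nu>. z $ j) = x $ j"
      using int[of "unit_idx j"] val[of "unit_idx j"] r by simp_all
    have int2: "integrable \<nu> (\<lambda>z. z $ j * z $ j)"
      and val2: "(LINT z|\<nu>. z $ j * z $ j) = x $ j * x $ j"
      using int[of "unit_idx j + unit_idx j"] val[of "unit_idx j + unit_idx j"] r
      by (simp_all add: monom_val_add)
    \<comment> \<open>The expanded square of \<open>z $ j - x $ j\<close>; the factor
      \<open>* 1\<close> presents the constant term as a multiple of the function in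
      \<open>int0\<close>.\<close>
    let ?f = "\<lambda>z. z $ j * z $ j - 2 * x $ j * z $ j + (x $ j)\<^sup>2 * 1"
    have intf: "integrable \<nu> ?f"
      using int0 int1 int2 by (intro Bochner_Integration.integrable_add
          Bochner_Integration.integrable_diff integrable_mult_right) auto
    have "(LINT z|\<nu>. ?f z) = 0"
      using int0 int1 int2 val1 val2
      by (simp add: total space power2_eq_square)
    moreover have f: "?f z = (z $ j - x $ j)\<^sup>2" for z
      by (simp add: power2_eq_square algebra_simps)
    ultimately have "AE z in \<nu>. (z $ j - x $ j)\<^sup>2 = 0"
      using intf unfolding f by (subst (asm) integral_nonneg_eq_0_iff_AE) auto
    then show ?thesis by eventually_elim simp
  qed
  have AE_eq: "AE z in \<nu>. z = x"
  proof -
    have "AE z in \<nu>. \<forall>j\<in>UNIV. z $ j = x $ j"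
      by (intro AE_finite_allI ae) simp
    then show ?thesis by eventually_elim (simp add: vec_eq_iff)
  qed
  have emeasure1: "emeasure \<nu> UNIV = 1"
    by (simp add: emeasure_eq_measure total)
  show ?thesis
  proof (rule measure_eqI)
    fix A assume "A \<in> sets \<nu>"
    then have [measurable]: "A \<in> sets borel" by (simp add: sets)
    \<comment> \<open>Up to a null set, \<open>A\<close> is everything or empty according to whether
      it contains \<open>x\<close>.\<close>
    have "emeasure \<nu> A = emeasure \<nu> (if x \<in> A then UNIV else {})"
      using AE_eq by (intro emeasure_eq_AE) (auto simp: sets elim!: eventually_mono)
    then show "emeasure \<nu> A = emeasure (return borel x) A"
      by (simp add: emeasure1 indicator_def split: if_splits)
  qed (simp add: sets)
qed

text \<open>Tightness asks for some optimal sequence, and a tight relaxation may also have optima of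
  higher rank, for instance mixtures of modes when \<open>p\<close> is constant. Hence the
  equivalence appears in three forms: under the rank hypothesis, existentially over optima, and for
  the point extracted from \<open>y\<close> itself.\<close>

theorem corollary2:
  fixes r :: nat and p :: "'n::finite mpol" and y :: "'n mindex \<Rightarrow> real"
  assumes "r \<ge> 1"
    and "total_deg p \<le> 2 * r"
    and "relax_optimal r p y"
  shows
    "(moment_rank r y = 1 \<and> moment_rank (r - 1) y = 1 \<longrightarrow>
       (\<exists>\<mu> lam.
          representing_measure r y \<mu> \<and>
          (\<forall>\<nu>. representing_measure r y \<nu> \<longrightarrow> \<nu> = \<mu>) \<and>
          (AE x in \<mu>. x = lam) \<and>
          (\<forall>\<alpha>\<in>midx (2 * r). y \<alpha> = monom_val lam \<alpha>) \<and>
          (\<exists>i. lam = axis i 1) \<and>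
          (\<forall>j. lam $ j = y (unit_idx j)) \<and>
          moment_mat y 0 0 = 1 \<and>
          (\<forall>j. moment_mat y 0 (unit_idx j) = lam $ j) \<and>
          (\<forall>j. moment_mat y (unit_idx j) 0 = lam $ j) \<and>
          (\<forall>i j. moment_mat y (unit_idx i) (unit_idx j) = lam $ i * lam $ j)) \<and>
       (tight r p \<longleftrightarrow> moment_rank r y = 1)) \<and>
     (tight r p \<longleftrightarrow> (\<exists>z. relax_optimal r p z \<and> moment_rank r z = 1)) \<and>
     (mode_optimal p (first_moments y) \<longleftrightarrow> moment_rank r y = 1)"
proof -
  have feas: "relax_feasible r y" using assms(3) by (simp add: relax_optimal_def)
  note iff = mode_optimal_iff_moment_rank[OF assms(1,2)]
  have tight_iff: "tight r p \<longleftrightarrow> (\<exists>z. relax_optimal r p z \<and> moment_rank r z = 1)"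
    unfolding tight_def using iff by blast
  have measure: "\<exists>\<mu> lam.
          representing_measure r y \<mu> \<and>
          (\<forall>\<nu>. representing_measure r y \<nu> \<longrightarrow> \<nu> = \<mu>) \<and>
          (AE x in \<mu>. x = lam) \<and>
          (\<forall>\<alpha>\<in>midx (2 * r). y \<alpha> = monom_val lam \<alpha>) \<and>
          (\<exists>i. lam = axis i 1) \<and>
          (\<forall>j. lam $ j = y (unit_idx j)) \<and>
          moment_mat y 0 0 = 1 \<and>
          (\<forall>j. moment_mat y 0 (unit_idx j) = lam $ j) \<and>
          (\<forall>j. moment_mat y (unit_idx j) 0 = lam $ j) \<and>
          (\<forall>i j. moment_mat y (unit_idx i) (unit_idx j) = lam $ i * lam $ j)"
    if rank: "moment_rank r y = 1"
  proof -
    let ?lam = "first_moments y"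
    have mode: "mode_feasible ?lam"
      using mode_feasible_iff_moment_rank[OF feas assms(1)] rank by simp
    then obtain i where i: "?lam = axis i 1" by (rule mode_feasible_axis)
    have y: "y \<alpha> = monom_val ?lam \<alpha>" if "mdeg \<alpha> \<le> 2 * r" for \<alpha>
      using relax_feasible_eq_monom_val[OF feas assms(1) mode that] .
    have square: "moment_mat y (unit_idx i) (unit_idx j) = ?lam $ i * ?lam $ j" for i j
      using y[of "unit_idx i + unit_idx j"] assms(1) by (simp add: moment_mat_def monom_val_add)
    have "representing_measure r y (return borel ?lam)"
      using y by (rule representing_measure_point)
    moreover have "\<forall>\<nu>. representing_measure r y \<nu> \<longrightarrow> \<nu> = return borel ?lam"
      using representing_measure_point_unique[OF y assms(1)] by blast
    moreover have "AE x in return borel ?lam. x = ?lam"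
      by (simp add: AE_return)
    moreover have "\<forall>\<alpha>\<in>midx (2 * r). y \<alpha> = monom_val ?lam \<alpha>"
      using y by (simp add: midx_def)
    moreover have "\<exists>i. ?lam = axis i 1"
      using i by blast
    moreover have "\<forall>j. ?lam $ j = y (unit_idx j)"
      by (simp add: first_moments_def)
    moreover from this relax_feasible_zero[OF feas] have "moment_mat y 0 0 = 1"
      "\<forall>j. moment_mat y 0 (unit_idx j) = ?lam $ j" "\<forall>j. moment_mat y (unit_idx j) 0 = ?lam $ j"
      by (simp_all add: moment_mat_def)
    ultimately show ?thesis
      using square by blast
  qed
  show ?thesis
    using measure tight_iff iff[OF assms(3)] assms(3) by blast
qed

end
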